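(* For all $a\in\mathbb{B}^n$ and all distinct $x,y\in\mathbb{B}^n$, $$h_{\mathbb{B}^n}(T_a(x),T_a(y))=2\,\operatorname{arsinh}\left(\sqrt{\frac{1-m_2^2}{1-m_1^2}}\;\sinh\frac{h_{\mathbb{B}^n}(x,y)}{2}\right),$$ where $m_1$ and $m_2$ are the Euclidean distances from the origin to the line $L(x,y)$ and to the line $L(T_a(x),T_a(y))$, respectively.
   Context: Let $n\ge 2$ and let $\mathbb{B}^n$ be the open Euclidean unit ball in $\mathbb{R}^n$, with boundary sphere $S^{n-1}$. For distinct $x,y\in\mathbb{R}^n$, $L(x,y)$ denotes the Euclidean line through $x$ and $y$. $\operatorname{arsinh}$ is the inverse of $\sinh$. Hilbert metric: for distinct $x,y\in\mathbb{B}^n$, $$h_{\mathbb{B}^n}(x,y)=\log\frac{|u-y|\,|x-v|}{|u-x|\,|y-v|},$$ where $u,v$ are the two points of $L(x,y)\cap S^{n-1}$, ordered so that $|u-x|<|u-y|$; and $h_{\mathbb{B}^n}(x,x)=0$. The logarithm is natural. Möbius transformation $T_a$: for $a\in\mathbb{B}^n\setminus\{0\}$, $T_a:\mathbb{B}^n\to\mathbb{B}^n$ is $T_a=p_a\circ\sigma_a$, where $\sigma_a$ is the inversion in the sphere with center $a^*=a/|a|^2$ and radius $R=\sqrt{1/|a|^2-1}$, i.e. $\sigma_a(z)=a^*+R^2(z-a^* )/|z-a^*|^2$, and $p_a$ is the reflection in the $(n-1)$-dimensional plane through the origin orthogonal to $a$. $T_0$ is the identity. *)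

theory Defs
  imports "HOL-Analysis.Analysis"
begin

abbreviation line_through :: "real ^ 'n \<Rightarrow> real ^ 'n \<Rightarrow> (real ^ 'n) set"
  where "line_through x y \<equiv> affine hull {x, y}"

text \<open>The pair \<open>(u, v)\<close> of points in which the line through \<open>x\<close> and \<open>y\<close> meets the unit
  sphere, with \<open>u\<close> on the side of \<open>x\<close>. It is well defined for distinct points of the open
  unit ball, by the lemma below.\<close>

definition chord_ends :: "real ^ 'n \<Rightarrow> real ^ 'n \<Rightarrow> (real ^ 'n) \<times> (real ^ 'n)"
  where "chord_ends x y =
    (THE (u, v). line_through x y \<inter> sphere 0 1 = {u, v} \<and> dist u x < dist u y)"

lemma chord_ends_unique:
  fixes x y :: "real ^ 'n"
  assumes "x \<in> ball 0 1" "y \<in> ball 0 1" "x \<noteq> y"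
  shows "\<exists>!(u, v). line_through x y \<inter> sphere 0 1 = {u, v} \<and> dist u x < dist u y"
proof -
  define d where "d = y - x"
  define A B C where "A = d \<bullet> d" and "B = x \<bullet> d" and "C = x \<bullet> x - 1"
  define D where "D = B\<^sup>2 - A * C"
  define s t where "s = (- B - sqrt D) / A" and "t = (- B + sqrt D) / A"
  define P where "P r = x + r *\<^sub>R d" for r :: real
  have A: "A > 0" using assms by (simp add: A_def d_def)
  have C: "C < 0" using assms by (simp add: C_def norm_eq_sqrt_inner)
  have D: "D > 0" unfolding D_def using mult_pos_neg[OF A C] zero_le_power2[of B] by linarith
  have nP: "P r \<bullet> P r - 1 = A * r\<^sup>2 + 2 * B * r + C" for r
    by (simp add: P_def A_def B_def C_def inner_simps inner_commute power2_eq_square algebra_simps)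
  have fac: "A * r\<^sup>2 + 2 * B * r + C = A * (r - s) * (r - t)" for r
  proof -
    have st: "s + t = - 2 * B / A" "s * t = C / A"
      using A D by (auto simp: s_def t_def D_def field_simps power2_eq_square)
    have "A * (r - s) * (r - t) = A * r\<^sup>2 - A * (s + t) * r + A * (s * t)"
      by (simp add: algebra_simps power2_eq_square)
    then show ?thesis using A st by simp
  qed
  have st: "s < t" using A D by (simp add: s_def t_def divide_strict_right_mono)
  have "A * (0 - s) * (0 - t) < 0" using fac[of 0] C by simp
  then have s0: "s < 0" using A st by (auto simp: mult_less_0_iff zero_less_mult_iff)
  have "P 1 = y" by (simp add: P_def d_def)
  moreover have "y \<bullet> y < 1" using assms by (simp add: norm_eq_sqrt_inner)
  ultimately have "A * (1 - s) * (1 - t) < 0" using fac[of 1] nP[of 1] by simp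
  then have t1: "t > 1" using A st s0 by (auto simp: mult_less_0_iff zero_less_mult_iff)
  have L: "line_through x y = range P"
  proof -
    have "u *\<^sub>R x + v *\<^sub>R y = P v" if "u + v = 1" for u v
    proof -
      have u: "u = 1 - v" using that by simp
      show ?thesis unfolding u by (simp add: P_def d_def algebra_simps)
    qed
    then have "line_through x y \<subseteq> range P" unfolding affine_hull_2 by blast
    moreover have "P r \<in> line_through x y" for r
    proof -
      have "P r = (1 - r) *\<^sub>R x + r *\<^sub>R y" by (simp add: P_def d_def algebra_simps)
      then show ?thesis unfolding affine_hull_2 by force
    qed
    ultimately show ?thesis by blast
  qed
  have "P r \<in> sphere 0 1 \<longleftrightarrow> r = s \<or> r = t" for r
  proof -
    have "P r \<in> sphere 0 1 \<longleftrightarrow> P r \<bullet> P r - 1 = 0" by (simp add: norm_eq_1)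
    then show ?thesis using nP[of r] fac[of r] A by auto
  qed
  then have I: "line_through x y \<inter> sphere 0 1 = {P s, P t}" unfolding L by auto
  have dx: "dist (P r) x = \<bar>r\<bar> * norm d" for r by (simp add: P_def dist_norm)
  have dy: "dist (P r) y = \<bar>r - 1\<bar> * norm d" for r
  proof -
    have "P r - y = (r - 1) *\<^sub>R d" by (simp add: P_def d_def algebra_simps)
    then show ?thesis by (simp add: dist_norm)
  qed
  have d: "norm d > 0" using assms by (simp add: d_def)
  have 1: "dist (P s) x < dist (P s) y" and 2: "\<not> dist (P t) x < dist (P t) y"
    using d s0 t1 by (simp_all add: dx dy left_diff_distrib)
  have "line_through x y \<inter> sphere 0 1 = {u, v} \<and> dist u x < dist u y
      \<longleftrightarrow> u = P s \<and> v = P t" for u v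
    unfolding I using 1 2 by (auto simp: doubleton_eq_iff)
  then show ?thesis by auto
qed

definition hilbert_dist :: "real ^ 'n \<Rightarrow> real ^ 'n \<Rightarrow> real"
  where "hilbert_dist x y =
    (if x = y then 0
     else let (u, v) = chord_ends x y
          in ln ((dist u y * dist x v) / (dist u x * dist y v)))"

definition sphere_inversion :: "real ^ 'n \<Rightarrow> real \<Rightarrow> real ^ 'n \<Rightarrow> real ^ 'n"
  where "sphere_inversion c R z = c + (R\<^sup>2 / (norm (z - c))\<^sup>2) *\<^sub>R (z - c)"

definition hyperplane_reflection :: "real ^ 'n \<Rightarrow> real ^ 'n \<Rightarrow> real ^ 'n"
  where "hyperplane_reflection a z = z - (2 * (z \<bullet> a) / (a \<bullet> a)) *\<^sub>R a"

definition moebius_T :: "real ^ 'n \<Rightarrow> real ^ 'n \<Rightarrow> real ^ 'n"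
  where "moebius_T a =
    (if a = 0 then id
     else hyperplane_reflection a
          \<circ> sphere_inversion ((1 / (norm a)\<^sup>2) *\<^sub>R a) (sqrt (1 / (norm a)\<^sup>2 - 1)))"

end

theory Submission
  imports Defs
begin

text \<open>
  After taking \<open>sinh\<close> of one half, the Hilbert distance and the hyperbolic distance \<open>\<rho>\<close> of the
  ball differ only by a factor that depends on how far the line is from the origin. Put
  \[ q(x,y) = \frac{|x-y|}{\sqrt{(1-|x|^2)(1-|y|^2)}}, \]
  which is \<open>sinh (\<rho> x y / 2)\<close> in the Poincare model. If \<open>m\<close> is the distance from the origin to
  the line through \<open>x\<close> and \<open>y\<close>, then
  \[ \sinh\frac{h(x,y)}{2} = \sqrt{1-m^2}\; q(x,y). \]
  To see this, write the ends of the chord as \<open>x + s (y - x)\<close> and \<open>x + t (y - x)\<close> with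
  \<open>s < 0\<close> and \<open>1 < t\<close>. Then \<open>exp h = (1 - s) t / ((- s) (t - 1))\<close>, whose numerator and
  denominator differ by \<open>t - s\<close>; hence
  \[ \sinh^2\frac{h}{2} = \frac{(e^h-1)^2}{4e^h} = \frac{(t-s)^2}{4(-s)t(1-s)(t-1)}. \]
  The powers of \<open>x\<close> and \<open>y\<close> with respect to the unit sphere are, up to sign,
  \<open>|x - y|\<^sup>2 (- s) t = 1 - |x|\<^sup>2\<close> and \<open>|x - y|\<^sup>2 (1 - s) (t - 1) = 1 - |y|\<^sup>2\<close>, and the chord has
  length \<open>(t - s) |x - y| = 2 sqrt (1 - m\<^sup>2)\<close>, which gives the formula
  (\<open>sinh_half_hilbert_dist\<close>).

  The quantity \<open>q\<close> is invariant under \<open>T\<^sub>a\<close>: the reflection is a linear isometry, and under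
  the inversion, whose sphere is orthogonal to the unit sphere, the distortion factors of \<open>|x - y|\<close> and of \<open>1 - |x|\<^sup>2\<close> cancel
  (\<open>moebius_T_preserves_ball_and_half_dist\<close>). Dividing the formula for \<open>T\<^sub>a x\<close>, \<open>T\<^sub>a y\<close> by
  the one for \<open>x\<close>, \<open>y\<close> therefore leaves the quotient of the two square roots.
\<close>

section \<open>Chords of the unit ball\<close>

lemma line_through_param:
  fixes x y :: "real ^ 'n"
  shows "line_through x y = range (\<lambda>r. x + r *\<^sub>R (y - x))"
proof -
  have "line_through x y = {u *\<^sub>R x + v *\<^sub>R y |u v. u + v = 1}"
    by (rule affine_hull_2)
  also have "\<dots> = range (\<lambda>v. (1 - v) *\<^sub>R x + v *\<^sub>R y)"
  proof (intro subset_antisym subsetI)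
    fix w
    assume "w \<in> {u *\<^sub>R x + v *\<^sub>R y |u v. u + v = 1}"
    then obtain u v where w: "w = u *\<^sub>R x + v *\<^sub>R y" and "u + v = 1" by blast
    then have "u = 1 - v" by simp
    with w show "w \<in> range (\<lambda>v. (1 - v) *\<^sub>R x + v *\<^sub>R y)" by simp
  qed force
  also have "(\<lambda>v. (1 - v) *\<^sub>R x + v *\<^sub>R y) = (\<lambda>r. x + r *\<^sub>R (y - x))"
    by (auto simp: algebra_simps)
  finally show ?thesis .
qed

lemma infdist_origin_line_sq:
  fixes x y :: "real ^ 'n"
  assumes "x \<noteq> y"
  defines "d \<equiv> y - x"
  shows "(infdist 0 (line_through x y))\<^sup>2 = x \<bullet> x - (x \<bullet> d)\<^sup>2 / (d \<bullet> d)"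
proof -
  have A: "d \<bullet> d > 0" using assms by simp
  \<comment> \<open>the foot of the perpendicular from the origin\<close>
  define p where "p = x - ((x \<bullet> d) / (d \<bullet> d)) *\<^sub>R d"
  have pd: "p \<bullet> d = 0" using A by (simp add: p_def inner_simps)
  have L: "line_through x y = range (\<lambda>r. p + r *\<^sub>R d)"
  proof -
    have 1: "x + r *\<^sub>R d = p + (r + (x \<bullet> d) / (d \<bullet> d)) *\<^sub>R d"
      and 2: "p + r *\<^sub>R d = x + (r - (x \<bullet> d) / (d \<bullet> d)) *\<^sub>R d" for r
      by (simp_all add: p_def algebra_simps)
    show ?thesis unfolding line_through_param d_def[symmetric]
      by (intro subset_antisym image_subsetI; rule range_eqI, rule 1 2)
  qed
  have "infdist 0 (line_through x y) = norm p"
  proof (rule antisym)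
    have "p \<in> line_through x y" unfolding L by (rule range_eqI[of _ _ 0]) simp
    then show "infdist 0 (line_through x y) \<le> norm p"
      using infdist_le[of p "line_through x y" 0] by simp
    have "norm p \<le> norm (p + r *\<^sub>R d)" for r
    proof -
      have "(p + r *\<^sub>R d) \<bullet> (p + r *\<^sub>R d) = p \<bullet> p + r\<^sup>2 * (d \<bullet> d)"
        using pd by (simp add: inner_simps inner_commute power2_eq_square)
      then show ?thesis using A by (simp add: norm_le)
    qed
    then show "norm p \<le> infdist 0 (line_through x y)"
      unfolding L by (auto simp: infdist_def intro!: cINF_greatest)
  qed
  moreover have "p \<bullet> p = p \<bullet> x" using pd by (simp add: p_def inner_simps)
  moreover have "p \<bullet> x = x \<bullet> x - (x \<bullet> d)\<^sup>2 / (d \<bullet> d)"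
    by (simp add: p_def inner_simps inner_commute power2_eq_square)
  ultimately show ?thesis by (simp add: power2_norm_eq_inner)
qed

text \<open>The signs \<open>s < 0\<close> and \<open>1 < t\<close> single out the two ends of the chord, since \<open>u\<close> must be the
  end that is nearer to \<open>x\<close> than to \<open>y\<close>.\<close>

lemma chord_ends_eqI:
  fixes x y :: "real ^ 'n"
  assumes "x \<in> ball 0 1" "y \<in> ball 0 1" "x \<noteq> y"
    and "s < 0" "1 < t"
    and "norm (x + s *\<^sub>R (y - x)) = 1" "norm (x + t *\<^sub>R (y - x)) = 1"
  shows "chord_ends x y = (x + s *\<^sub>R (y - x), x + t *\<^sub>R (y - x))"
proof -
  define P where "P r = x + r *\<^sub>R (y - x)" for r
  obtain u v where uv: "chord_ends x y = (u, v)" by force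
  have "case chord_ends x y of (u, v) \<Rightarrow>
      line_through x y \<inter> sphere 0 1 = {u, v} \<and> dist u x < dist u y"
    unfolding chord_ends_def by (rule theI'[OF chord_ends_unique[OF assms(1-3)]])
  then have I: "line_through x y \<inter> sphere 0 1 = {u, v}" and near: "dist u x < dist u y"
    by (auto simp: uv)
  have "P s \<in> {u, v}" "P t \<in> {u, v}"
    unfolding I[symmetric] using assms(6,7) by (auto simp: P_def line_through_param)
  moreover have "P s \<noteq> P t" using assms by (simp add: P_def)
  moreover have "u \<noteq> P t"
  proof
    assume u: "u = P t"
    have "P t - y = (t - 1) *\<^sub>R (y - x)" by (simp add: P_def algebra_simps)
    then have "dist (P t) y = (t - 1) * norm (y - x)" using assms by (simp add: dist_norm)
    moreover have "dist (P t) x = t * norm (y - x)" using assms by (simp add: dist_norm P_def)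
    moreover have "norm (y - x) > 0" using assms by simp
    ultimately show False using near unfolding u by (simp add: left_diff_distrib)
  qed
  ultimately show ?thesis unfolding uv P_def by auto
qed

text \<open>The parameters \<open>s\<close> and \<open>t\<close> are the roots of the quadratic \<open>|x + r (y - x)|\<^sup>2 - 1\<close> in \<open>r\<close>.
  Its values at \<open>r = 0\<close> and \<open>r = 1\<close> are the powers of \<open>x\<close> and \<open>y\<close>, and its discriminant is the
  squared length of the chord, up to the scale \<open>|y - x|\<close>.\<close>

lemma chord_parameters:
  fixes x y :: "real ^ 'n"
  assumes "x \<in> ball 0 1" "y \<in> ball 0 1" "x \<noteq> y"
  obtains s t where "s < 0" "1 < t"
    and "chord_ends x y = (x + s *\<^sub>R (y - x), x + t *\<^sub>R (y - x))"
    and "(dist x y)\<^sup>2 * (- s * t) = 1 - (norm x)\<^sup>2"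
    and "(dist x y)\<^sup>2 * ((1 - s) * (t - 1)) = 1 - (norm y)\<^sup>2"
    and "(dist x y)\<^sup>2 * (t - s)\<^sup>2 = 4 * (1 - (infdist 0 (line_through x y))\<^sup>2)"
proof -
  define d where "d = y - x"
  define A B C where "A = d \<bullet> d" and "B = x \<bullet> d" and "C = x \<bullet> x - 1"
  define D where "D = B\<^sup>2 - A * C"
  define s t where "s = (- B - sqrt D) / A" and "t = (- B + sqrt D) / A"
  have A: "A > 0" using assms by (simp add: A_def d_def)
  have x1: "(norm x)\<^sup>2 < 1" and y1: "(norm y)\<^sup>2 < 1"
    using assms by (auto simp: power_less_one_iff)
  have C: "C < 0" using x1 by (simp add: C_def power2_norm_eq_inner)
  have D: "D > 0" unfolding D_def using mult_pos_neg[OF A C] zero_le_power2[of B] by linarith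
  have nP: "(norm (x + r *\<^sub>R d))\<^sup>2 - 1 = A * r\<^sup>2 + 2 * B * r + C" for r
    unfolding power2_norm_eq_inner
    by (simp add: A_def B_def C_def inner_simps inner_commute power2_eq_square algebra_simps)
  have sum_prod: "s + t = - 2 * B / A" "s * t = C / A"
    using A D by (auto simp: s_def t_def D_def field_simps power2_eq_square)
  have nP': "(norm (x + r *\<^sub>R d))\<^sup>2 - 1 = A * ((r - s) * (r - t))" for r
  proof -
    have "A * ((r - s) * (r - t)) = A * r\<^sup>2 - A * (s + t) * r + A * (s * t)"
      by (simp add: algebra_simps power2_eq_square)
    then show ?thesis using nP[of r] sum_prod A by simp
  qed
  have px: "A * (- s * t) = 1 - (norm x)\<^sup>2" using nP'[of 0] by simp
  have py: "A * ((1 - s) * (t - 1)) = 1 - (norm y)\<^sup>2"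
    using nP'[of 1] by (simp add: d_def algebra_simps)
  have st: "s < t" using A D by (simp add: s_def t_def divide_strict_right_mono)
  have "- s * t > 0" using px x1 A by (metis diff_gt_0_iff_gt zero_less_mult_pos)
  then have s0: "s < 0" using st by (auto simp: mult_less_0_iff)
  have "(1 - s) * (t - 1) > 0" using py y1 A by (metis diff_gt_0_iff_gt zero_less_mult_pos)
  then have t1: "1 < t" using s0 by (auto simp: zero_less_mult_iff)
  have unit: "norm (x + s *\<^sub>R (y - x)) = 1" "norm (x + t *\<^sub>R (y - x)) = 1"
    using nP'[of s] nP'[of t] by (simp_all add: d_def power2_eq_1_iff)
      (smt (verit) norm_ge_zero)+
  have dA: "(dist x y)\<^sup>2 = A"
    unfolding dist_commute[of x y] by (simp only: dist_norm power2_norm_eq_inner A_def d_def)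
  have "t - s = 2 * sqrt D / A" by (simp add: t_def s_def diff_divide_distrib[symmetric])
  then have "A * (t - s)\<^sup>2 = 4 * (D / A)"
    using A D by (simp add: power_divide power_mult_distrib) (simp add: power2_eq_square)
  also have "D / A = 1 - (infdist 0 (line_through x y))\<^sup>2"
    using A infdist_origin_line_sq[OF assms(3)]
    by (simp add: D_def C_def A_def B_def d_def diff_divide_distrib)
  finally show thesis
    using that[OF s0 t1 chord_ends_eqI[OF assms s0 t1 unit]] px py by (simp add: dA)
qed

section \<open>The Hilbert distance in terms of the hyperbolic distance\<close>

definition sinh_half_hyperbolic_dist :: "real ^ 'n \<Rightarrow> real ^ 'n \<Rightarrow> real"
  where "sinh_half_hyperbolic_dist x y =
    dist x y / sqrt ((1 - (norm x)\<^sup>2) * (1 - (norm y)\<^sup>2))"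

lemma sinh_half_ln_sq:
  fixes E :: real
  assumes "E > 0"
  shows "(sinh (ln E / 2))\<^sup>2 = (E - 1)\<^sup>2 / (4 * E)"
proof -
  have "(E + inverse E) / 2 = cosh (ln E)" using assms by (simp add: cosh_ln_real)
  also have "\<dots> = 1 + 2 * (sinh (ln E / 2))\<^sup>2"
    using cosh_double[of "ln E / 2"] cosh_square_eq[of "ln E / 2"] by simp
  finally show ?thesis using assms by (simp add: field_simps power2_eq_square)
qed

lemma sinh_half_hilbert_dist:
  fixes x y :: "real ^ 'n"
  assumes "x \<in> ball 0 1" "y \<in> ball 0 1" "x \<noteq> y"
  defines "m \<equiv> infdist 0 (line_through x y)"
  shows "sinh (hilbert_dist x y / 2) = sqrt (1 - m\<^sup>2) * sinh_half_hyperbolic_dist x y"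
    and "m\<^sup>2 < 1"
proof -
  obtain s t where st: "s < 0" "1 < t"
    and ends: "chord_ends x y = (x + s *\<^sub>R (y - x), x + t *\<^sub>R (y - x))"
    and px: "(dist x y)\<^sup>2 * (- s * t) = 1 - (norm x)\<^sup>2"
    and py: "(dist x y)\<^sup>2 * ((1 - s) * (t - 1)) = 1 - (norm y)\<^sup>2"
    and chord: "(dist x y)\<^sup>2 * (t - s)\<^sup>2 = 4 * (1 - m\<^sup>2)"
    using chord_parameters[OF assms(1-3)] unfolding m_def by metis
  define l where "l = dist x y"
  have l: "l > 0" using assms by (simp add: l_def)
  have "l\<^sup>2 * (t - s)\<^sup>2 > 0" using l st by simp
  then show "m\<^sup>2 < 1" using chord by (simp add: l_def)
  define E where "E = ((1 - s) * t) / (- s * (t - 1))"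
  have den: "- s * (t - 1) > 0" using st by (intro mult_pos_pos) auto
  have num_den: "(1 - s) * t - (- s * (t - 1)) = t - s" by (simp add: algebra_simps)
  have E1: "E - 1 = (t - s) / (- s * (t - 1))"
    unfolding E_def num_den[symmetric] diff_divide_distrib using den
    by (subst divide_self) auto
  have E: "E > 1"
  proof -
    have "E - 1 > 0" unfolding E1 using den st by (intro divide_pos_pos) auto
    then show ?thesis by simp
  qed
  have "hilbert_dist x y = ln E"
  proof -
    have on_line: "dist (x + r *\<^sub>R (y - x)) x = \<bar>r\<bar> * l"
      "dist (x + r *\<^sub>R (y - x)) y = \<bar>r - 1\<bar> * l" for r
    proof -
      have "x + r *\<^sub>R (y - x) - y = (r - 1) *\<^sub>R (y - x)" by (simp add: algebra_simps)
      then show "dist (x + r *\<^sub>R (y - x)) y = \<bar>r - 1\<bar> * l"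
        by (simp add: dist_norm l_def norm_minus_commute)
    qed (simp add: dist_norm l_def norm_minus_commute)
    have "hilbert_dist x y = ln (((1 - s) * l * (t * l)) / (- s * l * ((t - 1) * l)))"
      using assms(3) st
      by (simp add: hilbert_dist_def ends on_line dist_commute[of x "x + z" for z]
          dist_commute[of y "x + z" for z])
    also have "((1 - s) * l * (t * l)) / (- s * l * ((t - 1) * l))
        = (((1 - s) * t) * (l * l)) / ((- s * (t - 1)) * (l * l))"
      by (simp only: mult_ac)
    also have "\<dots> = E" unfolding E_def using l by (intro mult_divide_mult_cancel_right) simp
    finally show ?thesis .
  qed
  then have h: "sinh (hilbert_dist x y / 2) = sqrt ((E - 1)\<^sup>2 / (4 * E))"
    using E sinh_half_ln_sq[of E] by (simp add: real_sqrt_unique)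
  have "(E - 1)\<^sup>2 / (4 * E) = (t - s)\<^sup>2 / (4 * ((- s * t) * ((1 - s) * (t - 1))))"
  proof -
    have "(k / q)\<^sup>2 / (4 * (p / q)) = k\<^sup>2 / (4 * (q * p))" if "q > 0" for k p q :: real
      using that by (simp add: power2_eq_square)
    from this[OF den] have "(E - 1)\<^sup>2 / (4 * E)
        = (t - s)\<^sup>2 / (4 * ((- s * (t - 1)) * ((1 - s) * t)))"
      unfolding E1 unfolding E_def .
    moreover have "(- s * (t - 1)) * ((1 - s) * t) = (- s * t) * ((1 - s) * (t - 1))"
      by (simp only: mult_ac)
    ultimately show ?thesis by (simp only:)
  qed
  also have "\<dots> = ((l\<^sup>2 * (t - s)\<^sup>2) * l\<^sup>2)
      / (4 * ((l\<^sup>2 * (- s * t)) * (l\<^sup>2 * ((1 - s) * (t - 1)))))"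
    using l by (simp add: divide_simps)
  also have "\<dots> = (1 - m\<^sup>2) * (l\<^sup>2 / ((1 - (norm x)\<^sup>2) * (1 - (norm y)\<^sup>2)))"
    unfolding l_def px py chord by (simp only: mult.assoc) simp
  finally show "sinh (hilbert_dist x y / 2) = sqrt (1 - m\<^sup>2) * sinh_half_hyperbolic_dist x y"
    using l unfolding h sinh_half_hyperbolic_dist_def l_def[symmetric]
    by (simp add: real_sqrt_mult real_sqrt_divide)
qed

section \<open>Moebius invariance\<close>

lemma norm_hyperplane_reflection: "norm (hyperplane_reflection a z) = norm z"
proof (cases "a = 0")
  case False
  then have "a \<bullet> a \<noteq> 0" by simp
  then have "hyperplane_reflection a z \<bullet> hyperplane_reflection a z = z \<bullet> z"
    by (simp add: hyperplane_reflection_def inner_simps inner_commute field_simps)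
  then show ?thesis by (simp add: norm_eq)
qed (simp add: hyperplane_reflection_def)

lemma dist_hyperplane_reflection:
  "dist (hyperplane_reflection a z) (hyperplane_reflection a w) = dist z w"
proof -
  have "hyperplane_reflection a z - hyperplane_reflection a w = hyperplane_reflection a (z - w)"
    by (simp add: hyperplane_reflection_def inner_simps diff_divide_distrib algebra_simps)
  then show ?thesis by (simp add: dist_norm norm_hyperplane_reflection)
qed

lemma dist_sphere_inversion_sq:
  assumes "x \<noteq> c" "y \<noteq> c"
  shows "(dist (sphere_inversion c R x) (sphere_inversion c R y))\<^sup>2
    = (R\<^sup>2)\<^sup>2 * (dist x y)\<^sup>2 / ((norm (x - c))\<^sup>2 * (norm (y - c))\<^sup>2)"
proof -
  define u v where "u = x - c" and "v = y - c"
  have nz: "u \<bullet> u \<noteq> 0" "v \<bullet> v \<noteq> 0" using assms by (simp_all add: u_def v_def)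
  have "sphere_inversion c R x - sphere_inversion c R y
      = R\<^sup>2 *\<^sub>R ((1 / (u \<bullet> u)) *\<^sub>R u - (1 / (v \<bullet> v)) *\<^sub>R v)"
    by (simp add: sphere_inversion_def power2_norm_eq_inner u_def v_def algebra_simps)
  moreover have "(norm ((1 / (u \<bullet> u)) *\<^sub>R u - (1 / (v \<bullet> v)) *\<^sub>R v))\<^sup>2
      = (u - v) \<bullet> (u - v) / ((u \<bullet> u) * (v \<bullet> v))"
    using nz by (simp add: power2_norm_eq_inner inner_simps inner_commute field_simps)
  moreover have "x - y = u - v" by (simp add: u_def v_def)
  ultimately show ?thesis
    by (simp add: dist_norm power_mult_distrib power2_norm_eq_inner u_def[symmetric] v_def[symmetric])
qed

text \<open>The condition \<open>|c|\<^sup>2 = 1 + R\<^sup>2\<close> says that the sphere of inversion is orthogonal to the unit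
  sphere, so that the inversion preserves the unit sphere; \<open>1 - |z|\<^sup>2\<close> is then only rescaled.\<close>

lemma one_minus_norm_sphere_inversion_sq:
  assumes "(norm c)\<^sup>2 = 1 + R\<^sup>2" "x \<noteq> c"
  shows "1 - (norm (sphere_inversion c R x))\<^sup>2 = R\<^sup>2 * (1 - (norm x)\<^sup>2) / (norm (x - c))\<^sup>2"
proof -
  define u where "u = x - c"
  have nz: "u \<bullet> u \<noteq> 0" using assms by (simp add: u_def)
  have x: "x = c + u" by (simp add: u_def)
  have cc: "c \<bullet> c = 1 + R\<^sup>2" using assms by (simp add: power2_norm_eq_inner)
  have "(norm (sphere_inversion c R x))\<^sup>2
      = (c + (R\<^sup>2 / (u \<bullet> u)) *\<^sub>R u) \<bullet> (c + (R\<^sup>2 / (u \<bullet> u)) *\<^sub>R u)"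
    by (simp add: sphere_inversion_def power2_norm_eq_inner u_def)
  also have "\<dots> = 1 + R\<^sup>2 + 2 * R\<^sup>2 * (c \<bullet> u) / (u \<bullet> u) + R\<^sup>2 * R\<^sup>2 / (u \<bullet> u)"
    using nz by (simp add: inner_simps inner_commute cc)
  finally have "1 - (norm (sphere_inversion c R x))\<^sup>2
      = R\<^sup>2 * (- (u \<bullet> u) - 2 * (c \<bullet> u) - R\<^sup>2) / (u \<bullet> u)"
    using nz by (simp add: field_simps)
  moreover have "1 - (norm x)\<^sup>2 = - (u \<bullet> u) - 2 * (c \<bullet> u) - R\<^sup>2"
    by (simp add: x power2_norm_eq_inner inner_simps inner_commute cc)
  ultimately show ?thesis by (simp add: power2_norm_eq_inner u_def)
qed

lemma moebius_T_preserves_ball_and_half_dist: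
  fixes a x y :: "real ^ 'n"
  assumes a: "a \<in> ball 0 1" and xy: "x \<in> ball 0 1" "y \<in> ball 0 1"
  shows "moebius_T a x \<in> ball 0 1"
    and "sinh_half_hyperbolic_dist (moebius_T a x) (moebius_T a y)
      = sinh_half_hyperbolic_dist x y"
proof -
  have "moebius_T a x \<in> ball 0 1 \<and>
    sinh_half_hyperbolic_dist (moebius_T a x) (moebius_T a y) = sinh_half_hyperbolic_dist x y"
  proof (cases "a = 0")
    case True
    then show ?thesis using xy by (simp add: moebius_T_def)
  next
    case False
    define c R where "c = (1 / (norm a)\<^sup>2) *\<^sub>R a" and "R = sqrt (1 / (norm a)\<^sup>2 - 1)"
    have na: "0 < norm a" "norm a < 1" using False a by auto
    then have "(norm a)\<^sup>2 < 1" by (simp add: power_less_one_iff)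
    then have R: "R\<^sup>2 = 1 / (norm a)\<^sup>2 - 1" "R\<^sup>2 > 0" using na by (auto simp: R_def)
    have c: "(norm c)\<^sup>2 = 1 + R\<^sup>2"
      using na R by (simp add: c_def power_mult_distrib power_divide power2_eq_square)
    have T: "moebius_T a = hyperplane_reflection a \<circ> sphere_inversion c R"
      using False by (simp add: moebius_T_def c_def R_def)
    have "norm c > 1"
      using c R by (smt (verit) norm_ge_zero power_le_one)
    then have ne: "x \<noteq> c" "y \<noteq> c" using xy by auto
    define X Y where "X = (norm (x - c))\<^sup>2" and "Y = (norm (y - c))\<^sup>2"
    have XY: "X > 0" "Y > 0" using ne by (simp_all add: X_def Y_def)
    have nx: "1 - (norm (moebius_T a x))\<^sup>2 = R\<^sup>2 * (1 - (norm x)\<^sup>2) / X"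
      and ny: "1 - (norm (moebius_T a y))\<^sup>2 = R\<^sup>2 * (1 - (norm y)\<^sup>2) / Y"
      using one_minus_norm_sphere_inversion_sq[OF c] ne
      by (simp_all add: T norm_hyperplane_reflection X_def Y_def)
    have dxy: "(dist (moebius_T a x) (moebius_T a y))\<^sup>2 = (R\<^sup>2)\<^sup>2 * (dist x y)\<^sup>2 / (X * Y)"
      using dist_sphere_inversion_sq[OF ne] by (simp add: T dist_hyperplane_reflection X_def Y_def)
    have sq: "sinh_half_hyperbolic_dist z w
        = sqrt ((dist z w)\<^sup>2 / ((1 - (norm z)\<^sup>2) * (1 - (norm w)\<^sup>2)))" for z w :: "real ^ 'n"
      by (simp add: sinh_half_hyperbolic_dist_def real_sqrt_divide)
    have x1: "(norm x)\<^sup>2 < 1" using xy by (simp add: power_less_one_iff)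
    have "1 - (norm (moebius_T a x))\<^sup>2 > 0"
      unfolding nx using R XY x1 by simp
    then have "moebius_T a x \<in> ball 0 1" by (simp add: power_less_one_iff)
    moreover have "sinh_half_hyperbolic_dist (moebius_T a x) (moebius_T a y)
        = sinh_half_hyperbolic_dist x y"
    proof -
      have cancel: "(k\<^sup>2 * l / (X * Y)) / ((k * p / X) * (k * q / Y)) = l / (p * q)"
        if "k > 0" for k l p q :: real
        using that XY by (simp add: field_simps power2_eq_square)
      show ?thesis unfolding sq nx ny dxy cancel[OF R(2)] ..
    qed
    ultimately show ?thesis by simp
  qed
  then show "moebius_T a x \<in> ball 0 1"
    and "sinh_half_hyperbolic_dist (moebius_T a x) (moebius_T a y)
      = sinh_half_hyperbolic_dist x y" by simp_all
qed

section \<open>The distortion of the Hilbert distance\<close>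

theorem corollary6p1:
  fixes a x y :: "real ^ 'n" and m1 m2 :: real
  assumes "CARD('n) \<ge> 2"
    and "a \<in> ball 0 1"
    and "x \<in> ball 0 1" and "y \<in> ball 0 1" and "x \<noteq> y"
    and "m1 = infdist 0 (line_through x y)"
    and "m2 = infdist 0 (line_through (moebius_T a x) (moebius_T a y))"
  shows "hilbert_dist (moebius_T a x) (moebius_T a y)
    = 2 * arsinh (sqrt ((1 - m2\<^sup>2) / (1 - m1\<^sup>2)) * sinh (hilbert_dist x y / 2))"
proof -
  define q where "q = sinh_half_hyperbolic_dist x y"
  have T: "moebius_T a x \<in> ball 0 1" "moebius_T a y \<in> ball 0 1"
    "sinh_half_hyperbolic_dist (moebius_T a x) (moebius_T a y) = q"
    using moebius_T_preserves_ball_and_half_dist assms(2-4) by (auto simp: q_def)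
  have "(norm x)\<^sup>2 < 1" "(norm y)\<^sup>2 < 1" using assms(3,4) by (simp_all add: power_less_one_iff)
  then have "q \<noteq> 0" using assms(5) by (simp add: q_def sinh_half_hyperbolic_dist_def)
  then have Tne: "moebius_T a x \<noteq> moebius_T a y"
    using T(3) by (auto simp: sinh_half_hyperbolic_dist_def)
  have h: "sinh (hilbert_dist x y / 2) = sqrt (1 - m1\<^sup>2) * q" and m1: "m1\<^sup>2 < 1"
    using sinh_half_hilbert_dist[OF assms(3-5)] by (simp_all add: assms(6) q_def)
  have "sinh (hilbert_dist (moebius_T a x) (moebius_T a y) / 2) = sqrt (1 - m2\<^sup>2) * q"
    using sinh_half_hilbert_dist(1)[OF T(1,2) Tne] by (simp add: assms(7) T(3))
  also have "\<dots> = sqrt ((1 - m2\<^sup>2) / (1 - m1\<^sup>2)) * sinh (hilbert_dist x y / 2)"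
    using m1 by (simp add: h real_sqrt_divide)
  finally show ?thesis by (metis arsinh_sinh_real field_sum_of_halves mult_2)
qed

end
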